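(* Let $\mathcal{X},\mathcal{Y}$ be Hilbert spaces and let $A:\mathcal{X}\to\mathcal{Y}$ be a bounded linear operator. (1) Assume that $A$ has a non-closed range. Then there exists a non-compact bounded linear operator $B:\mathcal{X}\to\mathcal{X}$ such that $AB$ is compact. (2) Conversely, suppose that the nullspace $N(A)$ is finite-dimensional and assume that there exists a non-compact bounded linear operator $B:\mathcal{X}\to\mathcal{X}$ such that $AB$ is compact. Then $A$ has a non-closed range.
   Context: $N(A)$ denotes the nullspace (kernel) of $A$. *)

theory Defs
  imports "HOL-Analysis.Analysis"
begin

text \<open>
  Real Hilbert spaces are the types of sort \<open>{real_inner, complete_space}\<close>. The classes below
  provide their complex counterparts. Extending \<^class>\<open>real_normed_vector\<close> makes the library's
  notions of boundedness, closedness and compactness available for the norm induced by the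
  Hermitian inner product, which is linear in its first argument.
\<close>

class complex_inner = real_normed_vector +
  fixes scaleC :: "complex \<Rightarrow> 'a \<Rightarrow> 'a" (infixr \<open>*\<^sub>C\<close> 75)
    and cinner :: "'a \<Rightarrow> 'a \<Rightarrow> complex"
  assumes scaleC_add_right: "a *\<^sub>C (x + y) = a *\<^sub>C x + a *\<^sub>C y"
    and scaleC_add_left: "(a + b) *\<^sub>C x = a *\<^sub>C x + b *\<^sub>C x"
    and scaleC_scaleC: "a *\<^sub>C b *\<^sub>C x = (a * b) *\<^sub>C x"
    and scaleC_one: "1 *\<^sub>C x = x"
    and scaleR_scaleC: "r *\<^sub>R x = complex_of_real r *\<^sub>C x"
    and cinner_commute: "cinner x y = cnj (cinner y x)"
    and cinner_add_left: "cinner (x + y) z = cinner x z + cinner y z"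
    and cinner_scaleC_left: "cinner (a *\<^sub>C x) y = a * cinner x y"
    and cinner_ge_zero: "0 \<le> Re (cinner x x)"
    and cinner_eq_zero_iff: "cinner x x = 0 \<longleftrightarrow> x = 0"
    and norm_eq_sqrt_cinner: "norm x = sqrt (Re (cinner x x))"

class complex_hilbert = complex_inner + complete_space

instantiation complex :: complex_hilbert
begin

definition scaleC_complex :: "complex \<Rightarrow> complex \<Rightarrow> complex"
  where "scaleC_complex a x = a * x"

definition cinner_complex :: "complex \<Rightarrow> complex \<Rightarrow> complex"
  where "cinner_complex x y = x * cnj y"

instance
  by standard
    (auto simp: scaleC_complex_def cinner_complex_def algebra_simps scaleR_conv_of_real
       cmod_def power2_eq_square)

end

lemma vector_space_scaleC: "vector_space (scaleC :: complex \<Rightarrow> 'a::complex_inner \<Rightarrow> 'a)"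
  by standard (simp_all add: scaleC_add_right scaleC_add_left scaleC_scaleC scaleC_one)

definition bounded_clinear :: "('a::complex_inner \<Rightarrow> 'b::complex_inner) \<Rightarrow> bool"
  where "bounded_clinear f \<longleftrightarrow>
    Vector_Spaces.linear scaleC scaleC f \<and> (\<exists>K. \<forall>x. norm (f x) \<le> norm x * K)"

text \<open>
  The constant \<^const>\<open>dim\<close> returns 0 on infinite-dimensional spaces, so finite dimension is
  expressed by a finite spanning set.
\<close>

definition finite_dimensional :: "('k::field \<Rightarrow> 'a::ab_group_add \<Rightarrow> 'a) \<Rightarrow> 'a set \<Rightarrow> bool"
  where "finite_dimensional smul V \<longleftrightarrow> (\<exists>S. finite S \<and> module.span smul S = V)"

text \<open>Linearity is not part of the following notion; it is required separately.\<close>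

definition compact_operator :: "('a::real_normed_vector \<Rightarrow> 'b::real_normed_vector) \<Rightarrow> bool"
  where "compact_operator f \<longleftrightarrow> (\<forall>S. bounded S \<longrightarrow> compact (closure (f ` S)))"

end

theory Submission
  imports Defs
begin

text \<open>
  (1) If \<open>A\<close> were bounded below on the orthogonal complement of a finite set, the image of that
  complement would be closed, and adding back finitely many lines would keep it closed. So when the
  range is not closed there is an orthonormal sequence \<open>e\<close> with \<open>norm (A (e n)) \<le> 2 ^ -n\<close>. Let \<open>B\<close>
  be the orthogonal projection onto its closed span: \<open>B\<close> fixes every \<open>e n\<close>, while \<open>A \<circ> B\<close> is a norm
  limit of operators of finite rank.

  (2) If the range is closed, the open mapping theorem gives preimages of controlled norm. A finite
  net of the image of a bounded set under \<open>A \<circ> B\<close> then lifts to a net of its image under \<open>B\<close>, up to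
  a bounded part of \<open>N(A)\<close>, which is relatively compact because \<open>N(A)\<close> is finite-dimensional.

  Both scalar fields are treated at once in locales over a normed field with compact balls.
\<close>

section \<open>Geometric series and compactness by approximation\<close>

lemma ex_geometric_less:
  fixes M d :: real
  assumes "d > 0"
  shows "\<exists>n. M * (1/2) ^ n < d"
proof -
  have "(\<lambda>n. M * (1/2) ^ n) \<longlonglongrightarrow> M * 0"
    by (intro tendsto_intros) auto
  then have "\<forall>\<^sub>F n in sequentially. M * (1/2) ^ n < d"
    using assms by (intro order_tendstoD) auto
  then show ?thesis
    using eventually_happens'[OF sequentially_bot] by blast
qed

lemma norm_sum_geometric_le:
  fixes f :: "nat \<Rightarrow> 'a::real_normed_vector"
  assumes f: "\<And>n. norm (f n) \<le> M * (1/2) ^ n"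
  shows "norm (sum f {m..<n}) \<le> 2 * M * (1/2) ^ m"
proof -
  have M: "0 \<le> M"
    using order_trans[OF norm_ge_zero f[of 0]] by simp
  have "(\<Sum>k=m..<n. (1/2) ^ k :: real) = 2 * (1/2) ^ m - 2 * (1/2) ^ n" if "m \<le> n"
    using that by (induction n rule: dec_induct) simp_all
  then have *: "(\<Sum>k=m..<n. (1/2) ^ k :: real) \<le> 2 * (1/2) ^ m"
    by (cases "m \<le> n") auto
  have "norm (sum f {m..<n}) \<le> (\<Sum>k=m..<n. M * (1/2) ^ k)"
    by (rule sum_norm_le) (rule f)
  also have "\<dots> \<le> M * (2 * (1/2) ^ m)"
    unfolding sum_distrib_left[symmetric] by (rule mult_left_mono[OF * M])
  finally show ?thesis by simp
qed

lemma sum_lessThan_diff: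
  fixes f :: "nat \<Rightarrow> 'a::ab_group_add"
  assumes "m \<le> n"
  shows "sum f {..<n} - sum f {..<m} = sum f {m..<n}"
  using assms sum_diff_nat_ivl[of 0 m n f] by (simp add: atLeast0LessThan)

text \<open>The explicit tail bound serves twice: with \<open>m = 0\<close> it controls the norm of
  a preimage built by successive correction, and for general \<open>m\<close> it gives the uniform
  rate at which finite-rank operators approximate \<open>A \<circ> B\<close>.\<close>

lemma
  fixes f :: "nat \<Rightarrow> 'a::{real_normed_vector, complete_space}"
  assumes f: "\<And>n. norm (f n) \<le> M * (1/2) ^ n"
  shows summable_geometric_bound: "summable f"
    and norm_suminf_diff_geometric_le: "norm (suminf f - sum f {..<m}) \<le> 2 * M * (1/2) ^ m"
proof -
  have "Cauchy (\<lambda>n. sum f {..<n})"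
  proof (rule metric_CauchyI)
    fix e :: real assume "0 < e"
    then obtain N where N: "2 * M * (1/2) ^ N < e / 2"
      using ex_geometric_less[of "e / 2" "2 * M"] by auto
    have "dist (sum f {..<n}) (sum f {..<N}) < e / 2" if "N \<le> n" for n
      using norm_sum_geometric_le[of f, OF f, where m=N and n=n] N that
      by (simp add: dist_norm sum_lessThan_diff)
    then have "dist (sum f {..<m}) (sum f {..<n}) < e" if "N \<le> m" "N \<le> n" for m n
      using that dist_triangle_half_l by metis
    then show "\<exists>N. \<forall>m\<ge>N. \<forall>n\<ge>N. dist (sum f {..<m}) (sum f {..<n}) < e"
      by blast
  qed
  then show s: "summable f"
    by (simp add: summable_iff_convergent Cauchy_convergent_iff)
  show "norm (suminf f - sum f {..<m}) \<le> 2 * M * (1/2) ^ m"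
  proof (rule Lim_bounded)
    show "(\<lambda>n. norm (sum f {..<n} - sum f {..<m})) \<longlonglongrightarrow> norm (suminf f - sum f {..<m})"
      by (intro tendsto_intros summable_LIMSEQ s)
    show "\<forall>n\<ge>m. norm (sum f {..<n} - sum f {..<m}) \<le> 2 * M * (1/2) ^ m"
      using norm_sum_geometric_le[of f, OF f] by (simp add: sum_lessThan_diff)
  qed
qed

text \<open>Compact nets suffice in place of finite ones, since each compact net has a finite net of
  its own; the three thirds of \<open>e\<close> pay for this refinement, for the given net and for
  passing to the closure.\<close>

lemma compact_closure_if_compact_nets:
  fixes T :: "'a::complete_space set"
  assumes "\<And>e. e > 0 \<Longrightarrow> \<exists>K. compact K \<and> T \<subseteq> (\<Union>x\<in>K. ball x e)"
  shows "compact (closure T)"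
  unfolding compact_eq_totally_bounded
proof (intro conjI allI impI)
  show "complete (closure T)"
    by (simp add: complete_eq_closed)
  fix e :: real assume e: "0 < e"
  then obtain K where K: "compact K" "T \<subseteq> (\<Union>x\<in>K. ball x (e/3))"
    using assms[of "e/3"] by auto
  obtain k where k: "finite k" "K \<subseteq> (\<Union>x\<in>k. ball x (e/3))"
    using K(1) e unfolding compact_eq_totally_bounded by (metis zero_less_divide_iff zero_less_numeral)
  have "closure T \<subseteq> (\<Union>x\<in>k. ball x e)"
  proof
    fix y assume "y \<in> closure T"
    then obtain t where t: "t \<in> T" "dist t y < e/3"
      using e unfolding closure_approachable by (metis zero_less_divide_iff zero_less_numeral)
    obtain x where x: "x \<in> K" "dist x t < e/3" using K t by auto
    obtain z where z: "z \<in> k" "dist z x < e/3" using k x by auto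
    have "dist z y < e"
      using dist_triangle[of z y x] dist_triangle[of x y t] t x z by simp
    then show "y \<in> (\<Union>x\<in>k. ball x e)" using z by auto
  qed
  then show "\<exists>k. finite k \<and> closure T \<subseteq> (\<Union>x\<in>k. ball x e)"
    using k by blast
qed

text \<open>The centres are images of points of \<open>S\<close>, so that a net of
  \<open>A (B S)\<close> can be traced back to finitely many points of \<open>B S\<close>.\<close>

lemma subset_image_ball_if_compact_closure:
  fixes f :: "'a \<Rightarrow> 'b::metric_space"
  assumes "compact (closure (f ` S))" "e > 0"
  obtains I where "I \<subseteq> S" "finite I" "f ` S \<subseteq> (\<Union>x\<in>I. ball (f x) e)"
proof -
  have "closure (f ` S) \<subseteq> (\<Union>x\<in>S. ball (f x) e)"
    using assms(2) by (fastforce simp: closure_approachable)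
  then show thesis
    using compactE_image[OF assms(1), of S "\<lambda>x. ball (f x) e"] closure_subset that
    by (metis open_ball subset_trans)
qed

subsection \<open>Operators with closed range\<close>

text \<open>
  By Baire's theorem some \<open>closure (A ` cball 0 n)\<close> contains a ball of the range; differences of its
  points give approximate preimages of all small vectors, and scaling gives the rest.
\<close>

lemma closed_range_imp_approx_preimage:
  fixes A :: "'a::real_normed_vector \<Rightarrow> 'b::{real_normed_vector, complete_space}"
  assumes "bounded_linear A" "closed (range A)"
  obtains C where "C > 0"
    "\<And>z. z \<in> range A \<Longrightarrow> \<exists>u. norm u \<le> C * norm z \<and> norm (z - A u) \<le> norm z / 2"
proof -
  interpret bounded_linear A by fact
  \<comment> \<open>Baire's theorem is applied inside \<open>range A\<close>, a complete metric
    space because it is closed; hence the sets \<open>?F n\<close> and all interiors are taken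
    relative to the range.\<close>
  interpret R: Submetric UNIV dist "range A"
    by unfold_locales auto
  let ?F = "\<lambda>n::nat. range A \<inter> closure (A ` cball 0 (real n))"
  have top: "R.sub.mtopology = top_of_set (range A)"
    by (simp add: R.mtopology_submetric)
  have "R.sub.mcomplete"
    using assms(2) by (intro R.closedin_mcomplete_imp_mcomplete) (auto simp: complete_eq_closed)
  have cl: "closedin R.sub.mtopology (?F n)" for n
    unfolding top by (simp add: closedin_closed_Int)
  have "\<Union> (range ?F) = range A"
  proof -
    have "A x \<in> ?F (nat \<lceil>norm x\<rceil>)" for x
      by (intro IntI rangeI closure_subset[THEN subsetD] imageI) (simp add: real_nat_ceiling_ge)
    then show ?thesis by blast
  qed
  moreover have "R.sub.mtopology interior_of (range A) \<noteq> {}"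
    unfolding top using interior_of_topspace[of "top_of_set (range A)"] by auto
  ultimately have "\<exists>T\<in>range ?F. R.sub.mtopology interior_of T \<noteq> {}"
    using R.sub.metric_Baire_category_alt[OF \<open>R.sub.mcomplete\<close>, of "range ?F"] cl by fastforce
  then obtain n y where y: "y \<in> R.sub.mtopology interior_of ?F n" by blast
  have "openin R.sub.mtopology (R.sub.mtopology interior_of ?F n)"
    by (rule openin_interior_of)
  then obtain r where r0: "r > 0" "R.sub.mball y r \<subseteq> R.sub.mtopology interior_of ?F n"
    using y unfolding R.sub.openin_mtopology by blast
  have r: "r > 0" "R.sub.mball y r \<subseteq> ?F n"
    using r0 interior_of_subset[of R.sub.mtopology "?F n"] by (blast intro: subset_trans)+
  have yR: "y \<in> ?F n"
    using y interior_of_subset[of R.sub.mtopology "?F n"] by blast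
  \<comment> \<open>Both \<open>y\<close> and \<open>y + z\<close> lie in \<open>?F n\<close>, so
    each is approximated by the image of a vector of norm at most \<open>n\<close>. The difference
    of these vectors almost hits \<open>z\<close>, at the price of the factor 2.\<close>
  have near: "\<exists>u. norm u \<le> 2 * n \<and> norm (z - A u) < d" if z: "z \<in> range A" "norm z < r" and d: "d > 0" for z d
  proof -
    have "y + z \<in> range A"
      using yR z by (auto simp flip: add)
    then have "y + z \<in> ?F n"
      using yR z by (intro subsetD[OF r(2)]) (simp add: R.sub.in_mball dist_norm)
    moreover have "\<exists>u. norm u \<le> n \<and> dist (A u) w < d/2" if "w \<in> ?F n" for w
    proof -
      have "w \<in> closure (A ` cball 0 (real n))"
        using that by blast
      then have "\<exists>y\<in>A ` cball 0 (real n). dist w y < d/2"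
        by (rule closure_approachableD) (use d in simp)
      then show ?thesis
        by (metis dist_commute imageE mem_cball_0)
    qed
    ultimately obtain u v where uv: "norm u \<le> n" "norm v \<le> n"
        "dist (A u) y < d/2" "dist (A v) (y+z) < d/2"
      using yR by meson
    have "norm (z - A (v - u)) = norm ((A u - y) - (A v - (y + z)))"
      by (simp add: diff algebra_simps)
    also have "\<dots> \<le> dist (A u) y + dist (A v) (y + z)"
      unfolding dist_norm by (rule norm_triangle_ineq4)
    also have "\<dots> < d"
      using uv by simp
    finally have "norm (z - A (v - u)) < d" .
    moreover have "norm (v - u) \<le> 2 * n"
      using uv norm_triangle_ineq4[of v u] by simp
    ultimately show ?thesis by blast
  qed
  show thesis
  \<comment> \<open>The \<open>+ 1\<close> keeps the constant positive when
    \<open>n = 0\<close>.\<close>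
  proof (rule that[of "4 * (real n + 1) / r"])
    show "4 * (real n + 1) / r > 0" using r by simp
    fix z assume z: "z \<in> range A"
    show "\<exists>u. norm u \<le> 4 * (real n + 1) / r * norm z \<and> norm (z - A u) \<le> norm z / 2"
    proof (cases "z = 0")
      case True then show ?thesis by (intro exI[of _ 0]) (simp add: zero)
    next
      case False
      \<comment> \<open>This scales \<open>z\<close> to norm \<open>r / 2\<close>; an error of
        \<open>r / 4\<close> there becomes half the norm of \<open>z\<close> after scaling
        back.\<close>
      define t where "t = r / (2 * norm z)"
      have t: "t > 0" using r False by (simp add: t_def)
      have "t *\<^sub>R z \<in> range A" "norm (t *\<^sub>R z) < r"
        using z r False by (auto simp: t_def simp flip: scaleR)
      then obtain u where u: "norm u \<le> 2 * n" "norm (t *\<^sub>R z - A u) < r / 4"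
        using near[of "t *\<^sub>R z" "r/4"] r by auto
      have "t *\<^sub>R (z - A (u /\<^sub>R t)) = t *\<^sub>R z - A u"
        using t by (simp add: scaleR scaleR_diff_right)
      then have "t * norm (z - A (u /\<^sub>R t)) < r / 4"
        using u t by (metis abs_of_pos norm_scaleR)
      then have "norm (z - A (u /\<^sub>R t)) \<le> norm z / 2"
        using r False by (simp add: t_def field_simps)
      moreover have "norm (u /\<^sub>R t) \<le> 2 * (real n + 1) / t"
        using u t by (simp add: field_simps)
      then have "norm (u /\<^sub>R t) \<le> 4 * (real n + 1) / r * norm z"
        by (simp add: t_def mult_ac)
      ultimately show ?thesis by blast
    qed
  qed
qed

text \<open>Approximate preimages are corrected repeatedly: the residue halves each time, so the
  corrections form a geometrically convergent series, and its sum is an exact preimage by continuity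
  of \<open>A\<close>.\<close>

lemma closed_range_imp_bounded_preimage:
  fixes A :: "'a::{real_normed_vector, complete_space} \<Rightarrow> 'b::{real_normed_vector, complete_space}"
  assumes A: "bounded_linear A" and "closed (range A)"
  obtains C where "C > 0" "\<And>x. \<exists>w. A w = A x \<and> norm w \<le> C * norm (A x)"
proof -
  interpret bounded_linear A by fact
  obtain C u where C: "C > 0"
    and u: "\<And>z. z \<in> range A \<Longrightarrow> norm (u z) \<le> C * norm z \<and> norm (z - A (u z)) \<le> norm z / 2"
    using closed_range_imp_approx_preimage[OF assms] by metis
  have "\<exists>w. A w = A x \<and> norm w \<le> 2 * C * norm (A x)" for x
  proof -
    \<comment> \<open>\<open>z n\<close> is the residue after \<open>n\<close> corrections. It stays
      in the range, which allows the next correction.\<close>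
    define z where "z = rec_nat (A x) (\<lambda>_ z. z - A (u z))"
    have z0: "z 0 = A x" and zS: "z (Suc n) = z n - A (u (z n))" for n
      by (simp_all add: z_def)
    have zR: "z n \<in> range A" for n
      by (induction n) (auto simp: z0 zS simp flip: diff)
    have nz: "norm (z n) \<le> norm (A x) * (1/2) ^ n" for n
    proof (induction n)
      case (Suc n)
      then show ?case using u[OF zR[of n]] by (simp add: zS)
    qed (simp add: z0)
    have nu: "norm (u (z n)) \<le> C * norm (A x) * (1/2) ^ n" for n
      using u[OF zR[of n]] nz[of n] C
      by (smt (verit) mult.assoc mult_left_mono)
    have sm: "summable (\<lambda>n. u (z n))"
      by (rule summable_geometric_bound) (rule nu)
    have "A (\<Sum>k<n. u (z k)) = A x - z n" for n
      by (induction n) (auto simp: z0 zS zero add)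
    then have "(\<lambda>n. A x - z n) \<longlonglongrightarrow> A (\<Sum>n. u (z n))"
      using tendsto[OF summable_LIMSEQ[OF sm]] by simp
    moreover have "z \<longlonglongrightarrow> 0"
    proof (rule Lim_null_comparison)
      show "\<forall>\<^sub>F n in sequentially. norm (z n) \<le> norm (A x) * (1/2) ^ n"
        using nz by simp
      show "(\<lambda>n. norm (A x) * (1/2) ^ n) \<longlonglongrightarrow> 0"
        by (auto intro!: tendsto_mult_right_zero LIMSEQ_power_zero)
    qed
    then have "(\<lambda>n. A x - z n) \<longlonglongrightarrow> A x"
      using tendsto_diff[OF tendsto_const] by fastforce
    ultimately have "A (\<Sum>n. u (z n)) = A x"
      by (rule LIMSEQ_unique)
    then show ?thesis
      using norm_suminf_diff_geometric_le[of "\<lambda>n. u (z n)" _ 0, OF nu] by (auto simp: mult.assoc)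
  qed
  then show thesis
    using C that[of "2 * C"] by simp
qed

subsection \<open>Normed spaces over a locally compact scalar field\<close>

locale normed_scalars = vector_space scale
  for scale :: "'k::{real_normed_field, heine_borel} \<Rightarrow> 'a::real_normed_vector \<Rightarrow> 'a" (infixr "\<cdot>" 75) +
  assumes norm_scale: "norm (c \<cdot> x) = norm c * norm x"
    and scale_of_real: "of_real r \<cdot> x = r *\<^sub>R x"
begin

text \<open>Needed because the library result on images under operators bounded below is stated for
  real subspaces.\<close>

lemma real_subspace: "subspace M \<Longrightarrow> real_vector.subspace M"
  using subspace_scale[of M _ "of_real _"]
  by (auto simp: real_vector.subspace_def subspace_0 subspace_add scale_of_real)

lemma continuous_on_scale: "continuous_on S (\<lambda>c. c \<cdot> v)"
proof (rule continuous_at_imp_continuous_on, rule ballI)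
  have "bounded_linear (\<lambda>c. c \<cdot> v)"
    by (rule bounded_linear_intro[where K="norm v"])
      (auto simp: scale_left_distrib norm_scale scaleR_conv_of_real[where 'a='k] simp flip: scale_of_real)
  then show "isCont (\<lambda>c. c \<cdot> v) c" for c
    by (rule linear_continuous_at)
qed

lemma tendsto_scale: "(c \<longlongrightarrow> l) F \<Longrightarrow> ((\<lambda>n. c n \<cdot> v) \<longlongrightarrow> l \<cdot> v) F"
  using continuous_on_tendsto_compose[OF continuous_on_scale[of UNIV v]] by auto

text \<open>Take for \<open>d\<close> the distance from \<open>v\<close> to \<open>M\<close>,
  positive as \<open>M\<close> is closed, and divide \<open>m + c \<cdot> v\<close> by
  \<open>c\<close>.\<close>

lemma coefficient_bound_off_subspace:
  assumes "subspace M" "closed M" "v \<notin> M"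
  obtains d where "d > 0" "\<And>m c. m \<in> M \<Longrightarrow> norm c * d \<le> norm (m + c \<cdot> v)"
proof
  have ne: "M \<noteq> {}" using subspace_0[OF assms(1)] by blast
  show "infdist v M > 0"
    using assms in_closure_iff_infdist_zero[OF ne, of v] infdist_nonneg[of v M] by (simp add: less_le)
  fix m c assume m: "m \<in> M"
  show "norm c * infdist v M \<le> norm (m + c \<cdot> v)"
  proof (cases "c = 0")
    case False
    have "- (inverse c \<cdot> m) \<in> M"
      using m assms(1) by (intro subspace_neg subspace_scale)
    then have "infdist v M \<le> norm (v + inverse c \<cdot> m)"
      using infdist_le[of "- (inverse c \<cdot> m)" M v] by (simp add: dist_norm)
    then have "norm c * infdist v M \<le> norm (c \<cdot> (v + inverse c \<cdot> m))"
      by (simp add: norm_scale mult_left_mono)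
    also have "c \<cdot> (v + inverse c \<cdot> m) = m + c \<cdot> v"
      using False by (simp add: scale_right_distrib)
    finally show ?thesis .
  qed simp
qed

text \<open>If \<open>v\<close> is not in \<open>M\<close>, the coefficient bound makes the
  coefficients of a convergent sequence Cauchy. They converge in the scalar field, so the components
  in \<open>M\<close> converge as well.\<close>

lemma closed_subspace_add_line:
  assumes M: "subspace M" "closed M"
  shows "closed {m + c \<cdot> v | m c. m \<in> M}"
proof (cases "v \<in> M")
  case True
  have "{m + c \<cdot> v | m c. m \<in> M} = M"
  proof
    show "M \<subseteq> {m + c \<cdot> v | m c. m \<in> M}"
      by (force intro: exI[of _ "0::'k"])
  qed (use True M in \<open>auto intro: subspace_add subspace_scale\<close>)
  then show ?thesis using M by simp
next
  case False
  obtain d where d: "d > 0" "\<And>m c. m \<in> M \<Longrightarrow> norm c * d \<le> norm (m + c \<cdot> v)"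
    using coefficient_bound_off_subspace[OF M False] by metis
  show ?thesis
    unfolding closed_sequential_limits
  proof (intro allI impI, elim conjE)
    fix x l assume x: "\<forall>n::nat. x n \<in> {m + c \<cdot> v | m c. m \<in> M}" and l: "x \<longlonglongrightarrow> l"
    then obtain m c where mc: "\<And>n. m n \<in> M" "\<And>n. x n = m n + c n \<cdot> v"
      by simp metis
    have dc: "norm (c i - c j) * d \<le> dist (x i) (x j)" for i j
      using d(2)[of "m i - m j" "c i - c j"] mc subspace_diff[OF M(1)]
      by (simp add: dist_norm scale_left_diff_distrib algebra_simps)
    have "Cauchy c"
    proof (rule metric_CauchyI)
      fix e :: real assume "0 < e"
      then obtain N where "\<forall>i\<ge>N. \<forall>j\<ge>N. dist (x i) (x j) < e * d"
        using metric_CauchyD[OF LIMSEQ_imp_Cauchy[OF l], of "e * d"] d(1) by auto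
      then have "\<forall>i\<ge>N. \<forall>j\<ge>N. norm (c i - c j) * d < e * d"
        using dc le_less_trans by blast
      then show "\<exists>N. \<forall>i\<ge>N. \<forall>j\<ge>N. dist (c i) (c j) < e"
        using d(1) by (auto simp: dist_norm)
    qed
    then obtain a where "c \<longlonglongrightarrow> a"
      using Cauchy_convergent_iff convergent_def by blast
    then have "(\<lambda>n. x n - c n \<cdot> v) \<longlonglongrightarrow> l - a \<cdot> v"
      by (intro tendsto_diff l tendsto_scale)
    then have "m \<longlonglongrightarrow> l - a \<cdot> v"
      by (simp add: mc(2))
    then have "l - a \<cdot> v \<in> M"
      using closed_sequentially[OF M(2)] mc(1) by blast
    moreover have "l = (l - a \<cdot> v) + a \<cdot> v" by simp
    ultimately show "l \<in> {m + c \<cdot> v | m c. m \<in> M}" by blast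
  qed
qed

lemma compact_scaled_cball: "compact ((\<lambda>c. c \<cdot> v) ` cball 0 r)"
  by (intro compact_continuous_image continuous_on_scale compact_cball)

text \<open>This is the compactness of a finite-rank operator on bounded sets; the set is a sum of
  compact images of scalar balls.\<close>

lemma bounded_combinations_in_compact:
  "\<exists>K. compact K \<and> (\<forall>c. (\<forall>k. norm (c k) \<le> R) \<longrightarrow> (\<Sum>k<n. c k \<cdot> v k) \<in> K)" for n :: nat
proof (induction n)
  case 0
  show ?case by (intro exI[of _ "{0}"]) simp
next
  case (Suc n)
  then obtain K where K: "compact K" "\<And>c. (\<forall>k. norm (c k) \<le> R) \<Longrightarrow> (\<Sum>k<n. c k \<cdot> v k) \<in> K"
    by blast
  let ?K = "{x + y | x y. x \<in> K \<and> y \<in> (\<lambda>c. c \<cdot> v n) ` cball 0 R}"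
  have "(\<Sum>k<Suc n. c k \<cdot> v k) \<in> ?K" if "\<forall>k. norm (c k) \<le> R" for c
  proof -
    have "(\<Sum>k<n. c k \<cdot> v k) \<in> K" "c n \<cdot> v n \<in> (\<lambda>c. c \<cdot> v n) ` cball 0 R"
      using K(2) that by auto
    then show ?thesis unfolding sum.lessThan_Suc by blast
  qed
  moreover have "compact ?K"
    by (intro compact_sums K compact_scaled_cball)
  ultimately show ?case by blast
qed

lemma compact_span_Int_cball:
  assumes "finite S"
  shows "compact (span S \<inter> cball 0 r)"
  using assms
proof (induction S arbitrary: r)
  case empty
  have "span {} \<inter> cball 0 r = (if 0 \<le> r then {0} else {})" by auto
  then show ?case by simp
next
  case (insert v S)
  \<comment> \<open>A convergent sequence lies in some ball, so compactness of all balls of the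
    span, available since \<open>r\<close> is arbitrary in the induction, already gives
    closedness.\<close>
  have closed: "closed (span S)"
    unfolding closed_sequential_limits
  proof (intro allI impI, elim conjE)
    fix x l assume x: "\<forall>n::nat. x n \<in> span S" and l: "x \<longlonglongrightarrow> l"
    then obtain R where "\<And>n. norm (x n) \<le> R"
      using convergent_imp_bounded[OF l] by (auto simp: bounded_iff)
    then show "l \<in> span S"
      using closed_sequentially[OF compact_imp_closed[OF insert.IH[of R]] _ l] x by auto
  qed
  show ?case
  proof (cases "v \<in> span S")
    case True
    then show ?thesis using insert.IH by (simp add: span_redundant)
  next
    case False
    then obtain d where d: "d > 0" "\<And>m c. m \<in> span S \<Longrightarrow> norm c * d \<le> norm (m + c \<cdot> v)"
      using coefficient_bound_off_subspace[OF subspace_span closed False] by metis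
    have span: "span (insert v S) = {m + c \<cdot> v | m c. m \<in> span S}"
    proof -
      have "x \<in> span (insert v S) \<longleftrightarrow> (\<exists>m c. x = m + c \<cdot> v \<and> m \<in> span S)" for x
        unfolding span_insert mem_Collect_eq
        by (metis (no_types) add_diff_cancel_right' diff_add_cancel)
      then show ?thesis by blast
    qed
    \<comment> \<open>For \<open>x = m + c \<cdot> v\<close> of norm at most \<open>r\<close>, the
      coefficient satisfies \<open>norm c \<le> r / d\<close>, and the triangle inequality then
      bounds \<open>m = x - c \<cdot> v\<close>.\<close>
    let ?K = "{x + y | x y. x \<in> span S \<inter> cball 0 (r + r / d * norm v) \<and> y \<in> (\<lambda>c. c \<cdot> v) ` cball 0 (r / d)}"
    have K: "compact ?K"
      by (intro compact_sums insert.IH compact_scaled_cball)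
    have "closed (span (insert v S))"
      unfolding span by (intro closed_subspace_add_line subspace_span closed)
    then have "compact (?K \<inter> (span (insert v S) \<inter> cball 0 r))"
      by (intro compact_Int_closed K closed_Int closed_cball)
    moreover have "span (insert v S) \<inter> cball 0 r \<subseteq> ?K"
    proof clarify
      fix x assume "x \<in> span (insert v S)" and r: "x \<in> cball 0 r"
      then obtain m c where x: "x = m + c \<cdot> v" and m: "m \<in> span S"
        unfolding span by blast
      have c: "norm c \<le> r / d"
        using d(1) d(2)[OF m, of c] r x by (simp add: field_simps)
      then have "norm (c \<cdot> v) \<le> r / d * norm v"
        unfolding norm_scale by (rule mult_right_mono) simp
      then have "norm m \<le> r + r / d * norm v"
        using norm_triangle_ineq4[of x "c \<cdot> v"] r x by simp
      then show "\<exists>x' y. x = x' + y \<and> x' \<in> span S \<inter> cball 0 (r + r / d * norm v)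
          \<and> y \<in> (\<lambda>c. c \<cdot> v) ` cball 0 (r / d)"
        using x m c by (intro exI[of _ m] exI[of _ "c \<cdot> v"]) auto
    qed
    ultimately show ?thesis by (simp add: Int_absorb1)
  qed
qed

end

section \<open>Lifting compactness through an operator with closed range\<close>

locale banach_scalars = normed_scalars scale
  for scale :: "'k::{real_normed_field, heine_borel} \<Rightarrow> 'a::{real_normed_vector, complete_space} \<Rightarrow> 'a"
    (infixr "\<cdot>" 75)
begin

lemma compact_operator_if_compact_comp:
  fixes A :: "'a \<Rightarrow> 'b::{real_normed_vector, complete_space}" and B :: "'c::real_normed_vector \<Rightarrow> 'a"
  assumes A: "bounded_linear A" and cl: "closed (range A)"
    and ker: "finite_dimensional scale {x. A x = 0}"
    and B: "bounded_linear B" and AB: "compact_operator (A \<circ> B)"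
  shows "compact_operator B"
  unfolding compact_operator_def
proof (intro allI impI)
  interpret A: bounded_linear A by fact
  fix S :: "'c set" assume S: "bounded S"
  obtain C where C: "C > 0" and pre: "\<And>x. \<exists>w. A w = A x \<and> norm w \<le> C * norm (A x)"
    using closed_range_imp_bounded_preimage[OF A cl] by metis
  have "bounded (B ` S)"
    using S B by (rule bounded_linear_image)
  then obtain R where R: "\<And>x. x \<in> S \<Longrightarrow> norm (B x) \<le> R"
    by (auto simp: bounded_iff)
  obtain F where F: "finite F" "span F = {x. A x = 0}"
    using ker unfolding finite_dimensional_def by blast
  show "compact (closure (B ` S))"
  proof (rule compact_closure_if_compact_nets)
    fix e :: real assume e: "e > 0"
    have "compact (closure ((\<lambda>x. A (B x)) ` S))"
      using AB S by (simp add: compact_operator_def o_def)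
    \<comment> \<open>With this radius the controlled preimage \<open>w\<close> of
      \<open>A (B x - B i)\<close> has norm below \<open>e\<close>.\<close>
    moreover have "e / C > 0" using e C by simp
    ultimately obtain I where I: "I \<subseteq> S" "finite I"
        "(\<lambda>x. A (B x)) ` S \<subseteq> (\<Union>x\<in>I. ball (A (B x)) (e / C))"
      by (rule subset_image_ball_if_compact_closure)
    \<comment> \<open>\<open>B x - B i - w\<close> lies in the kernel and has norm at most
      \<open>2 * R + e\<close>. Adding it to \<open>B i\<close> gives a point of \<open>?K\<close>
      that differs from \<open>B x\<close> only by \<open>w\<close>.\<close>
    let ?K = "{x + y | x y. x \<in> B ` I \<and> y \<in> span F \<inter> cball 0 (2 * R + e)}"
    have "compact ?K"
      using I(2) by (intro compact_sums finite_imp_compact compact_span_Int_cball F finite_imageI)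
    moreover have "B ` S \<subseteq> (\<Union>x\<in>?K. ball x e)"
    proof clarify
      fix x assume x: "x \<in> S"
      then obtain i where i: "i \<in> I" "dist (A (B i)) (A (B x)) < e / C"
        using I(3) by fastforce
      obtain w where w: "A w = A (B x - B i)" "norm w \<le> C * norm (A (B x - B i))"
        using pre by blast
      have "norm w < e"
        using w(2) i(2) C by (simp add: A.diff dist_norm norm_minus_commute field_simps)
      moreover have "norm (B x - B i - w) \<le> 2 * R + norm w"
        using norm_triangle_ineq4[of "B x - B i" w] norm_triangle_ineq4[of "B x" "B i"]
          R[OF x] R[of i] i I by auto
      moreover have "B x - B i - w \<in> span F"
        using w(1) by (simp add: F A.diff)
      ultimately have "B x - B i - w \<in> span F \<inter> cball 0 (2 * R + e)"
        and near: "dist (B i + (B x - B i - w)) (B x) < e"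
        using norm_minus_commute[of w "B x - B i"] by (auto simp: dist_norm)
      then have "B i + (B x - B i - w) \<in> ?K"
        using i(1) by blast
      then show "B x \<in> (\<Union>x\<in>?K. ball x e)"
        using near by (intro UN_I) (simp_all only: mem_ball)
    qed
    ultimately show "\<exists>K. compact K \<and> B ` S \<subseteq> (\<Union>x\<in>K. ball x e)" by blast
  qed
qed

end

subsection \<open>Inner products\<close>

text \<open>
  Conjugate symmetry enters only through the last two assumptions, so that no conjugation on the
  scalar field is needed.
\<close>

locale hilbert_scalars = banach_scalars scale
  for scale :: "'k::{real_normed_field, heine_borel} \<Rightarrow> 'a::{real_normed_vector, complete_space} \<Rightarrow> 'a"
    (infixr "\<cdot>" 75) +
  fixes ip :: "'a \<Rightarrow> 'a \<Rightarrow> 'k"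
  assumes ip_add: "ip (x + y) z = ip x z + ip y z"
    and ip_scale: "ip (c \<cdot> x) y = c * ip x y"
    and ip_self: "ip x x = of_real ((norm x)\<^sup>2)"
    and orthogonal_sym: "ip x y = 0 \<Longrightarrow> ip y x = 0"
    and pythagoras: "ip x y = 0 \<Longrightarrow> (norm (x + y))\<^sup>2 = (norm x)\<^sup>2 + (norm y)\<^sup>2"
begin

lemma ip_zero [simp]: "ip 0 y = 0"
  using ip_scale[of 0 0 y] by simp

lemma ip_diff: "ip (x - y) z = ip x z - ip y z"
  using ip_add[of "x - y" y z] by (simp add: algebra_simps)

lemma ip_sum: "ip (sum f I) z = (\<Sum>i\<in>I. ip (f i) z)"
  by (induction I rule: infinite_finite_induct) (auto simp: ip_add)

lemma ip_self_eq_1_iff: "ip x x = 1 \<longleftrightarrow> norm x = 1"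
  unfolding ip_self using of_real_eq_iff[of "(norm x)\<^sup>2" 1, where 'a='k] norm_ge_zero[of x]
  by (auto simp: power2_eq_1_iff simp del: of_real_eq_iff of_real_power norm_ge_zero)

text \<open>Cauchy-Schwarz, from Pythagoras: the projection of \<open>x\<close> onto the line of
  \<open>y\<close> is no longer than \<open>x\<close>.\<close>

lemma norm_ip_le: "norm (ip x y) \<le> norm x * norm y"
proof (cases "y = 0")
  case True
  then show ?thesis using orthogonal_sym[of 0 x] by simp
next
  case False
  let ?c = "ip x y / of_real ((norm y)\<^sup>2)"
  have "ip (x - ?c \<cdot> y) y = 0"
    using False by (simp add: ip_diff ip_scale ip_self)
  then have "ip (x - ?c \<cdot> y) (?c \<cdot> y) = 0"
    by (metis ip_scale mult_zero_right orthogonal_sym)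
  then have "(norm x)\<^sup>2 = (norm (x - ?c \<cdot> y))\<^sup>2 + (norm (?c \<cdot> y))\<^sup>2"
    using pythagoras[of "x - ?c \<cdot> y" "?c \<cdot> y"] by simp
  then have "norm (?c \<cdot> y) \<le> norm x"
    by (metis le_add_same_cancel2 norm_ge_zero power2_le_imp_le zero_le_power2)
  then show ?thesis
    using False by (simp add: norm_scale norm_divide norm_mult power2_eq_square field_simps)
qed

lemma bounded_linear_ip: "bounded_linear (\<lambda>x. ip x y)"
  by (rule bounded_linear_intro[where K="norm y"])
    (auto simp: ip_add ip_scale norm_ip_le scaleR_conv_of_real[where 'a='k] simp flip: scale_of_real)

section \<open>Orthogonal complements and orthonormal expansions\<close>

definition orthogonal_to :: "'a set \<Rightarrow> 'a set"
  where "orthogonal_to S = {x. \<forall>s\<in>S. ip x s = 0}"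

lemma subspace_orthogonal_to: "subspace (orthogonal_to S)"
  by (auto simp: subspace_def orthogonal_to_def ip_add ip_scale)

lemma closed_orthogonal_to: "closed (orthogonal_to S)"
proof -
  have "orthogonal_to S = (\<Inter>s\<in>S. (\<lambda>x. ip x s) -` {0})"
    by (auto simp: orthogonal_to_def)
  moreover have "closed ((\<lambda>x. ip x s) -` {0})" for s
    by (intro closed_vimage closed_singleton linear_continuous_on bounded_linear_ip)
  ultimately show ?thesis by auto
qed

text \<open>The lower index is free so that initial sums and the blocks in a Cauchy argument are
  both covered.\<close>

lemma sum_scale_orthonormal:
  fixes e :: "nat \<Rightarrow> 'a"
  assumes e: "\<And>i j. ip (e i) (e j) = (if i = j then 1 else 0)"
  shows "(norm (\<Sum>k=m..<n. c k \<cdot> e k))\<^sup>2 = (\<Sum>k=m..<n. (norm (c k))\<^sup>2)"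
proof (induction n)
  case (Suc n)
  have "ip (\<Sum>k=m..<n. c k \<cdot> e k) (e n) = 0"
    by (simp add: ip_sum ip_scale e)
  then have "ip (\<Sum>k=m..<n. c k \<cdot> e k) (c n \<cdot> e n) = 0"
    by (metis ip_scale mult_zero_right orthogonal_sym)
  moreover have "norm (e n) = 1"
    using e[of n n] by (simp add: ip_self_eq_1_iff)
  ultimately show ?case
    using Suc by (auto simp: pythagoras norm_scale)
qed simp

lemma bessel_inequality:
  fixes e :: "nat \<Rightarrow> 'a"
  assumes e: "\<And>i j. ip (e i) (e j) = (if i = j then 1 else 0)"
  shows "(\<Sum>k<n. (norm (ip x (e k)))\<^sup>2) \<le> (norm x)\<^sup>2"
proof -
  define s where "s = (\<Sum>k<n. ip x (e k) \<cdot> e k)"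
  \<comment> \<open>Subtracting the projection \<open>s\<close> leaves a remainder orthogonal to
    each \<open>e k\<close> with \<open>k < n\<close>, hence to \<open>s\<close>, so Pythagoras
    splits the norm of \<open>x\<close>.\<close>
  have "ip (x - s) (e k) = 0" if "k < n" for k
  proof -
    have "ip s (e k) = (\<Sum>i<n. if i = k then ip x (e i) else 0)"
      unfolding s_def ip_sum ip_scale e by (rule sum.cong) auto
    then show ?thesis using that by (simp add: ip_diff)
  qed
  then have "ip (e k) (x - s) = 0" if "k < n" for k
    using that orthogonal_sym by blast
  then have "ip s (x - s) = 0"
    by (simp add: s_def ip_sum ip_scale)
  then have "(norm x)\<^sup>2 = (norm s)\<^sup>2 + (norm (x - s))\<^sup>2"
    using pythagoras[of s "x - s"] by simp
  then show ?thesis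
    using sum_scale_orthonormal[of e "\<lambda>k. ip x (e k)" 0 n, OF e]
    by (simp add: s_def atLeast0LessThan)
qed

text \<open>Bessel makes the squared coefficients summable, and Pythagoras turns their Cauchy
  criterion into one for the vectors.\<close>

lemma summable_orthonormal_expansion:
  fixes e :: "nat \<Rightarrow> 'a"
  assumes e: "\<And>i j. ip (e i) (e j) = (if i = j then 1 else 0)"
  shows "summable (\<lambda>k. ip x (e k) \<cdot> e k)"
proof -
  let ?c = "\<lambda>k. ip x (e k)"
  have sm: "summable (\<lambda>k. (norm (?c k))\<^sup>2)"
    using bessel_inequality[of e, OF e] by (intro summableI_nonneg_bounded) auto
  have "Cauchy (\<lambda>n. \<Sum>k<n. ?c k \<cdot> e k)"
    unfolding Cauchy_altdef2
  proof (intro allI impI)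
    fix d :: real assume "d > 0"
    then obtain N where N: "\<And>m n. N \<le> m \<Longrightarrow> norm (\<Sum>k=m..<n. (norm (?c k))\<^sup>2) < d\<^sup>2"
      using sm unfolding summable_Cauchy by (meson zero_less_power)
    have "dist (\<Sum>k<n. ?c k \<cdot> e k) (\<Sum>k<N. ?c k \<cdot> e k) < d" if "N \<le> n" for n
    proof -
      have "(norm (\<Sum>k=N..<n. ?c k \<cdot> e k))\<^sup>2 < d\<^sup>2"
        using N[of N n] unfolding sum_scale_orthonormal[of e, OF e] by auto
      then have "norm (\<Sum>k=N..<n. ?c k \<cdot> e k) < d"
        using \<open>d > 0\<close> by (intro power2_less_imp_less[of _ d]) auto
      then show ?thesis
        unfolding dist_norm sum_lessThan_diff[OF that] .
    qed
    then show "\<exists>N. \<forall>n\<ge>N. dist (\<Sum>k<n. ?c k \<cdot> e k) (\<Sum>k<N. ?c k \<cdot> e k) < d"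
      by blast
  qed
  then show ?thesis
    by (simp add: summable_iff_convergent Cauchy_convergent_iff)
qed

end

subsection \<open>Bounded operators between the spaces\<close>

text \<open>The library's \<open>bounded_linear\<close> speaks of real scalars; real homogeneity
  follows since real multiples embed into both scalar multiplications.\<close>

lemma bounded_linear_if_linear_scale:
  assumes "normed_scalars s1" "normed_scalars s2" and f: "Vector_Spaces.linear s1 s2 f"
    and K: "\<And>x. norm (f x) \<le> norm x * K"
  shows "bounded_linear f"
proof -
  interpret f: Vector_Spaces.linear s1 s2 f by fact
  show ?thesis
    by (rule bounded_linear_intro[OF f.add _ K])
      (metis assms(1,2) f.scale normed_scalars.scale_of_real)
qed

locale bounded_operator = X: hilbert_scalars scale ip + Y: banach_scalars scale'
  for scale :: "'k::{real_normed_field, heine_borel} \<Rightarrow> 'a::{real_normed_vector, complete_space} \<Rightarrow> 'a"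
    (infixr "\<cdot>" 75)
    and ip :: "'a \<Rightarrow> 'a \<Rightarrow> 'k"
    and scale' :: "'k \<Rightarrow> 'b::{real_normed_vector, complete_space} \<Rightarrow> 'b"
    (infixr "\<cdot>''" 75) +
  fixes A :: "'a \<Rightarrow> 'b"
  assumes linear: "Vector_Spaces.linear scale scale' A"
    and bounded_linear: "bounded_linear A"
begin

sublocale A: Vector_Spaces.linear scale scale' A
  by (rule linear)

lemma closed_image_if_closed_image_Int_hyperplane:
  assumes V: "X.subspace V" and cl: "closed (A ` (V \<inter> X.orthogonal_to {s}))"
  shows "closed (A ` V)"
proof (cases "V \<subseteq> X.orthogonal_to {s}")
  case True
  then show ?thesis using cl by (simp add: Int_absorb2)
next
  case False
  then obtain v where v: "v \<in> V" "ip v s \<noteq> 0"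
    by (auto simp: X.orthogonal_to_def)
  \<comment> \<open>Normalised so that \<open>x - ip x s \<cdot> w\<close> is orthogonal to
    \<open>s\<close>.\<close>
  define w where "w = (1 / ip v s) \<cdot> v"
  have w: "w \<in> V" "ip w s = 1"
    using v X.subspace_scale[OF V] by (auto simp: w_def X.ip_scale)
  let ?H = "V \<inter> X.orthogonal_to {s}"
  have "A ` V = {m + c \<cdot>' A w | m c. m \<in> A ` ?H}"
  proof (intro equalityI subsetI)
    fix y assume "y \<in> A ` V"
    then obtain x where x: "x \<in> V" "y = A x" by blast
    have "x - ip x s \<cdot> w \<in> ?H"
      using x w X.subspace_diff[OF V] X.subspace_scale[OF V]
      by (auto simp: X.orthogonal_to_def X.ip_diff X.ip_scale)
    moreover have "y = A (x - ip x s \<cdot> w) + ip x s \<cdot>' A w"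
      using x by (simp add: A.diff A.scale)
    ultimately show "y \<in> {m + c \<cdot>' A w | m c. m \<in> A ` ?H}" by blast
  next
    fix y assume "y \<in> {m + c \<cdot>' A w | m c. m \<in> A ` ?H}"
    then obtain m c where "m \<in> V" "y = A m + c \<cdot>' A w" by blast
    then have "m + c \<cdot> w \<in> V" "y = A (m + c \<cdot> w)"
      using w X.subspace_add[OF V] X.subspace_scale[OF V] by (auto simp: A.add A.scale)
    then show "y \<in> A ` V" by blast
  qed
  moreover have "Y.subspace (A ` ?H)"
    by (intro A.subspace_image X.subspace_inter V X.subspace_orthogonal_to)
  ultimately show ?thesis
    using Y.closed_subspace_add_line[of "A ` ?H" "A w"] cl by (simp only:)
qed

lemma closed_range_if_closed_image_orthogonal:
  assumes "finite S" "closed (A ` X.orthogonal_to S)"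
  shows "closed (range A)"
  using assms
proof (induction S)
  case empty
  then show ?case by (simp add: X.orthogonal_to_def)
next
  case (insert s S)
  have "X.orthogonal_to (insert s S) = X.orthogonal_to S \<inter> X.orthogonal_to {s}"
    by (auto simp: X.orthogonal_to_def)
  then show ?case
    using insert closed_image_if_closed_image_Int_hyperplane[OF X.subspace_orthogonal_to] by metis
qed

text \<open>Otherwise \<open>A\<close> is bounded below by \<open>d\<close> on the complement, whose
  image is then complete; adding back finitely many lines would close the range.\<close>

lemma small_image_orthogonal_to_finite:
  assumes "\<not> closed (range A)" "finite S" "d > 0"
  shows "\<exists>x. norm x = 1 \<and> x \<in> X.orthogonal_to S \<and> norm (A x) \<le> d"
proof (rule ccontr)
  assume contra: "\<not> ?thesis"
  interpret bA: bounded_linear A by (rule bounded_linear)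
  have below: "d * norm x \<le> norm (A x)" if x: "x \<in> X.orthogonal_to S" for x
  proof (cases "x = 0")
    case False
    have "x /\<^sub>R norm x \<in> X.orthogonal_to S"
      using x X.real_subspace[OF X.subspace_orthogonal_to] real_vector.subspace_scale by blast
    moreover have "norm (x /\<^sub>R norm x) = 1" using False by simp
    ultimately have "d < norm (A (x /\<^sub>R norm x))"
      using contra by force
    then show ?thesis
      using False by (simp add: bA.scaleR field_simps)
  qed (simp add: bA.zero)
  have "complete (A ` X.orthogonal_to S)"
    using below
    by (intro complete_isometric_image[OF assms(3)] X.real_subspace X.subspace_orthogonal_to bounded_linear)
      (auto simp: complete_eq_closed X.closed_orthogonal_to)
  then show False
    using closed_range_if_closed_image_orthogonal assms by (auto simp: complete_eq_closed)
qed

lemma orthonormal_sequence_small_image: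
  assumes "\<not> closed (range A)"
  obtains e :: "nat \<Rightarrow> 'a"
  where "\<And>i j. ip (e i) (e j) = (if i = j then 1 else 0)" "\<And>n. norm (A (e n)) \<le> (1/2) ^ n"
proof -
  let ?P = "\<lambda>f (n::nat) r. norm r = 1 \<and> r \<in> X.orthogonal_to (f ` {..<n}) \<and> norm (A r) \<le> (1/2) ^ n"
  have "\<exists>e. \<forall>n. ?P e n (e n)"
  proof (rule dependent_wellorder_choice)
    \<comment> \<open>The condition on the \<open>n\<close>-th vector looks only at earlier ones, as
      recursive choice requires.\<close>
    show "?P f n r = ?P g n r" if "\<And>k. k < n \<Longrightarrow> f k = g k" for f g :: "nat \<Rightarrow> 'a" and n r
      using that by (auto simp: X.orthogonal_to_def)
    show "\<exists>r. ?P f n r" for f :: "nat \<Rightarrow> 'a" and n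
      by (rule small_image_orthogonal_to_finite[OF assms]) auto
  qed
  then obtain e where e: "\<And>n. ?P e n (e n)" by blast
  have "ip (e i) (e j) = 0" if "j < i" for i j
    using e[of i] that by (auto simp: X.orthogonal_to_def)
  then have "ip (e i) (e j) = (if i = j then 1 else 0)" for i j
    using e X.orthogonal_sym by (metis X.ip_self_eq_1_iff nat_neq_iff)
  then show thesis using that e by blast
qed

lemma noncompact_with_compact_comp:
  assumes "\<not> closed (range A)"
  shows "\<exists>B. Vector_Spaces.linear scale scale B \<and> bounded_linear B \<and>
    \<not> compact_operator B \<and> compact_operator (A \<circ> B)"
proof -
  interpret bA: bounded_linear A by (rule bounded_linear)
  obtain e :: "nat \<Rightarrow> 'a" where e: "\<And>i j. ip (e i) (e j) = (if i = j then 1 else 0)"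
    and Ae: "\<And>n. norm (A (e n)) \<le> (1/2) ^ n"
    using orthonormal_sequence_small_image[OF assms] by blast
  have ne: "norm (e n) = 1" for n
    using e[of n n] by (simp add: X.ip_self_eq_1_iff)
  define B where "B x = (\<Sum>k. ip x (e k) \<cdot> e k)" for x
  have sm: "summable (\<lambda>k. ip x (e k) \<cdot> e k)" for x
    by (rule X.summable_orthonormal_expansion) (rule e)
  \<comment> \<open>Continuity of scalar multiplication lets a scalar be pulled out of the infinite
    sum defining \<open>B\<close>.\<close>
  have bl_scale: "bounded_linear (\<lambda>x. c \<cdot> x)" for c
    by (rule bounded_linear_if_linear_scale[OF X.normed_scalars_axioms X.normed_scalars_axioms X.linear_scale_self, where K="norm c"])
      (simp add: X.norm_scale)
  have linB: "Vector_Spaces.linear scale scale B"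
  proof
    show "B (x + y) = B x + B y" for x y
      unfolding B_def X.ip_add X.scale_left_distrib by (rule suminf_add[symmetric]) (rule sm)+
    show "B (c \<cdot> x) = c \<cdot> B x" for c x
      unfolding B_def X.ip_scale bounded_linear.suminf[OF bl_scale sm] by simp
  qed
  have norm_B: "norm (B x) \<le> norm x" for x
  proof (rule Lim_bounded)
    show "(\<lambda>n. norm (\<Sum>k<n. ip x (e k) \<cdot> e k)) \<longlonglongrightarrow> norm (B x)"
      unfolding B_def by (intro tendsto_norm summable_LIMSEQ sm)
    have "(norm (\<Sum>k<n. ip x (e k) \<cdot> e k))\<^sup>2 \<le> (norm x)\<^sup>2" for n
      using X.bessel_inequality[of e x n, OF e] X.sum_scale_orthonormal[of e _ 0 n, OF e]
      by (simp add: atLeast0LessThan)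
    then show "\<forall>n\<ge>0. norm (\<Sum>k<n. ip x (e k) \<cdot> e k) \<le> norm x"
      by (auto intro: power2_le_imp_le)
  qed
  then have blB: "bounded_linear B"
    using bounded_linear_if_linear_scale[OF X.normed_scalars_axioms X.normed_scalars_axioms linB, of 1] by simp
  have Be: "B (e n) = e n" for n
  proof -
    have "(\<lambda>k. ip (e n) (e k) \<cdot> e k) = (\<lambda>k. if k = n then e k else 0)"
      by (auto simp: e)
    then show ?thesis
      unfolding B_def using sums_unique[OF sums_single[of n e]] by simp
  qed
  \<comment> \<open>The vectors \<open>e n\<close> are fixed by \<open>B\<close> and at mutual
    distance \<open>sqrt 2\<close>, so no subsequence is Cauchy.\<close>
  have "\<not> compact_operator B"
  proof
    assume "compact_operator B"
    then have "compact (closure (B ` cball 0 1))"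
      by (simp add: compact_operator_def)
    moreover have "e n \<in> closure (B ` cball 0 1)" for n
      using Be[of n] ne[of n] by (intro closure_subset[THEN subsetD]) (force intro: image_eqI[of _ _ "e n"])
    ultimately obtain l r where r: "strict_mono r" "(e \<circ> r) \<longlonglongrightarrow> l"
      unfolding compact_def by metis
    then obtain N where N: "\<And>m n. m \<ge> N \<Longrightarrow> n \<ge> N \<Longrightarrow> dist ((e \<circ> r) m) ((e \<circ> r) n) < 1"
      using metric_CauchyD[OF LIMSEQ_imp_Cauchy, of "e \<circ> r" l 1] by auto
    have "r N \<noteq> r (Suc N)"
      using r(1) by (simp add: strict_mono_eq)
    then have "ip (e (r N)) (- e (r (Suc N))) = 0"
      using e by (metis X.ip_scale X.orthogonal_sym X.scale_minus_left X.scale_one mult_zero_right)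
    from X.pythagoras[OF this] have "(norm (e (r N) - e (r (Suc N))))\<^sup>2 = 2"
      by (simp add: ne)
    moreover have "(norm (e (r N) - e (r (Suc N))))\<^sup>2 < 1"
      using N[of N "Suc N"] by (simp add: dist_norm power_less_one_iff abs_square_less_1)
    ultimately show False by simp
  qed
  moreover have "compact_operator (A \<circ> B)"
    unfolding compact_operator_def
  proof (intro allI impI)
    fix S :: "'a set" assume "bounded S"
    then obtain R where R: "R > 0" "\<And>x. x \<in> S \<Longrightarrow> norm x \<le> R"
      by (auto simp: bounded_pos)
    have coeff: "norm (ip x (e k)) \<le> R" if "x \<in> S" for x k
      using X.norm_ip_le[of x "e k"] R(2)[OF that] by (simp add: ne)
    show "compact (closure ((A \<circ> B) ` S))"
    proof (rule compact_closure_if_compact_nets)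
      fix d :: real assume "d > 0"
      then obtain N where N: "2 * R * (1/2) ^ N < d"
        using ex_geometric_less[of d "2 * R"] by blast
      \<comment> \<open>\<open>K\<close> holds the first \<open>N\<close> terms of the series for
        \<open>A (B x)\<close>, for all \<open>x\<close> in \<open>S\<close> at once; the choice of
        \<open>N\<close> makes the remaining tail smaller than \<open>d\<close>.\<close>
      obtain K where K: "compact K" "\<And>c. (\<forall>k. norm (c k) \<le> R) \<Longrightarrow> (\<Sum>k<N. c k \<cdot>' A (e k)) \<in> K"
        using Y.bounded_combinations_in_compact[where n=N and R=R and v="\<lambda>k. A (e k)"] by blast
      have "A (B x) \<in> (\<Union>y\<in>K. ball y d)" if x: "x \<in> S" for x
      proof -
        let ?f = "\<lambda>k. ip x (e k) \<cdot>' A (e k)"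
        have f: "norm (?f k) \<le> R * (1/2) ^ k" for k
          unfolding Y.norm_scale using R(1) by (intro mult_mono coeff[OF x] Ae) auto
        have "A (B x) = suminf ?f"
          unfolding B_def bA.suminf[OF sm] by (simp add: A.scale)
        then have "dist (\<Sum>k<N. ?f k) (A (B x)) < d"
          using norm_suminf_diff_geometric_le[of ?f R N, OF f] N
          by (simp add: dist_norm norm_minus_commute)
        moreover have "(\<Sum>k<N. ?f k) \<in> K"
          using K(2)[of "\<lambda>k. ip x (e k)"] coeff[OF x] by simp
        ultimately show ?thesis by auto
      qed
      then show "\<exists>K. compact K \<and> (A \<circ> B) ` S \<subseteq> (\<Union>x\<in>K. ball x d)"
        using K(1) by auto
    qed
  qed
  ultimately show ?thesis using linB blB by blast
qed

lemma not_closed_range_if_noncompact_with_compact_comp: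
  fixes B :: "'a \<Rightarrow> 'a"
  assumes "finite_dimensional scale {x. A x = 0}"
    and "bounded_linear B" "\<not> compact_operator B" "compact_operator (A \<circ> B)"
  shows "\<not> closed (range A)"
  using X.compact_operator_if_compact_comp[OF bounded_linear _ assms(1,2,4)] assms(3) by blast

end

subsection \<open>Real and complex Hilbert spaces\<close>

lemma hilbert_scalars_real:
  "hilbert_scalars (scaleR :: real \<Rightarrow> 'a::{real_inner, complete_space} \<Rightarrow> 'a) inner"
proof
  show "(norm (x + y))\<^sup>2 = (norm x)\<^sup>2 + (norm y)\<^sup>2" if "inner x y = 0" for x y :: 'a
    using that by (simp add: power2_norm_eq_inner inner_add inner_commute)
qed (auto simp: inner_left_distrib inner_commute power2_norm_eq_inner algebra_simps)

section \<open>Identities for the complex inner product\<close>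

lemma cinner_add_right: "cinner x (y + z) = cinner x y + cinner x (z :: 'a::complex_inner)"
  by (metis cinner_add_left cinner_commute complex_cnj_add)

lemma cinner_scaleC_right: "cinner x (c *\<^sub>C y) = cnj c * cinner x (y :: 'a::complex_inner)"
  by (metis cinner_commute cinner_scaleC_left complex_cnj_mult)

lemma cinner_self: "cinner x x = complex_of_real ((norm (x :: 'a::complex_inner))\<^sup>2)"
proof (rule complex_eqI)
  \<comment> \<open>Hermitian symmetry makes \<open>cinner x x\<close> equal to its own
    conjugate.\<close>
  show "Im (cinner x x) = Im (complex_of_real ((norm x)\<^sup>2))"
    using arg_cong[OF cinner_commute[of x x], of Im] by simp
qed (simp add: norm_eq_sqrt_cinner cinner_ge_zero)

text \<open>The class gives homogeneity of the norm for real scalars only; for complex ones it comes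
  from the inner product.\<close>

lemma norm_scaleC: "norm (c *\<^sub>C x) = norm c * norm (x :: 'a::complex_inner)"
proof -
  have "complex_of_real ((norm (c *\<^sub>C x))\<^sup>2) = (c * cnj c) * complex_of_real ((norm x)\<^sup>2)"
    unfolding cinner_self[symmetric] by (simp add: cinner_scaleC_left cinner_scaleC_right)
  also have "\<dots> = complex_of_real ((norm c * norm x)\<^sup>2)"
    unfolding complex_norm_square[symmetric] by (simp add: power_mult_distrib)
  finally have "(norm (c *\<^sub>C x))\<^sup>2 = (norm c * norm x)\<^sup>2"
    unfolding of_real_eq_iff .
  then show ?thesis by (rule power2_eq_imp_eq) auto
qed

lemma hilbert_scalars_complex:
  "hilbert_scalars (scaleC :: complex \<Rightarrow> 'a::complex_hilbert \<Rightarrow> 'a) cinner"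
proof -
  interpret vector_space "scaleC :: complex \<Rightarrow> 'a \<Rightarrow> 'a"
    by (rule vector_space_scaleC)
  show ?thesis
  proof
    show sym: "cinner y x = 0" if "cinner x y = 0" for x y :: 'a
      using that cinner_commute[of y x] by simp
    show "(norm (x + y))\<^sup>2 = (norm x)\<^sup>2 + (norm y)\<^sup>2" if "cinner x y = 0" for x y :: 'a
    proof -
      have "complex_of_real ((norm (x + y))\<^sup>2) = complex_of_real ((norm x)\<^sup>2 + (norm y)\<^sup>2)"
        unfolding of_real_add cinner_self[symmetric]
        by (simp add: cinner_add_left cinner_add_right that sym[OF that])
      then show ?thesis unfolding of_real_eq_iff .
    qed
  qed (simp_all add: norm_scaleC scaleR_scaleC cinner_add_left cinner_scaleC_left cinner_self)
qed

text \<open>Translates between complex boundedness and the pair of conditions used in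
  \<open>bounded_operator\<close>.\<close>

lemma bounded_clinear_iff:
  fixes f :: "'a::complex_hilbert \<Rightarrow> 'b::complex_hilbert"
  shows "bounded_clinear f \<longleftrightarrow> Vector_Spaces.linear scaleC scaleC f \<and> bounded_linear f"
proof -
  note normed = banach_scalars.axioms[OF hilbert_scalars.axioms(1)[OF hilbert_scalars_complex]]
  show ?thesis
    unfolding bounded_clinear_def
    using bounded_linear_if_linear_scale[OF normed normed, of f] bounded_linear.bounded[of f]
    by blast
qed

theorem theorem4:
  fixes A :: "'x::{real_inner, complete_space} \<Rightarrow> 'y::{real_inner, complete_space}"
    and A' :: "'u::complex_hilbert \<Rightarrow> 'v::complex_hilbert"
  shows
    "(bounded_linear A \<longrightarrow>
       (\<not> closed (range A) \<longrightarrow>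
         (\<exists>B :: 'x \<Rightarrow> 'x. bounded_linear B \<and> \<not> compact_operator B \<and> compact_operator (A \<circ> B))) \<and>
       (finite_dimensional scaleR {x. A x = 0} \<and>
         (\<exists>B :: 'x \<Rightarrow> 'x. bounded_linear B \<and> \<not> compact_operator B \<and> compact_operator (A \<circ> B))
         \<longrightarrow> \<not> closed (range A)))
     \<and>
     (bounded_clinear A' \<longrightarrow>
       (\<not> closed (range A') \<longrightarrow>
         (\<exists>B :: 'u \<Rightarrow> 'u. bounded_clinear B \<and> \<not> compact_operator B \<and> compact_operator (A' \<circ> B))) \<and>
       (finite_dimensional scaleC {x. A' x = 0} \<and>
         (\<exists>B :: 'u \<Rightarrow> 'u. bounded_clinear B \<and> \<not> compact_operator B \<and> compact_operator (A' \<circ> B))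
         \<longrightarrow> \<not> closed (range A')))"
proof (intro conjI impI)
  assume A: "bounded_linear A"
  interpret bounded_operator scaleR inner scaleR A
    by (intro bounded_operator.intro bounded_operator_axioms.intro hilbert_scalars_real
        hilbert_scalars.axioms(1)[OF hilbert_scalars_real] A bounded_linear.linear[OF A, unfolded linear_def])
  show "\<exists>B :: 'x \<Rightarrow> 'x. bounded_linear B \<and> \<not> compact_operator B \<and> compact_operator (A \<circ> B)"
    if "\<not> closed (range A)"
    using noncompact_with_compact_comp[OF that] by blast
  show "\<not> closed (range A)"
    if "finite_dimensional scaleR {x. A x = 0} \<and>
      (\<exists>B :: 'x \<Rightarrow> 'x. bounded_linear B \<and> \<not> compact_operator B \<and> compact_operator (A \<circ> B))"
    using that not_closed_range_if_noncompact_with_compact_comp by blast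
next
  assume A': "bounded_clinear A'"
  interpret bounded_operator scaleC cinner scaleC A'
    using A' unfolding bounded_clinear_iff
    by (intro bounded_operator.intro bounded_operator_axioms.intro hilbert_scalars_complex
        hilbert_scalars.axioms(1)[OF hilbert_scalars_complex]) simp_all
  show "\<exists>B :: 'u \<Rightarrow> 'u. bounded_clinear B \<and> \<not> compact_operator B \<and> compact_operator (A' \<circ> B)"
    if "\<not> closed (range A')"
    using noncompact_with_compact_comp[OF that] by (auto simp: bounded_clinear_iff)
  show "\<not> closed (range A')"
    if "finite_dimensional scaleC {x. A' x = 0} \<and>
      (\<exists>B :: 'u \<Rightarrow> 'u. bounded_clinear B \<and> \<not> compact_operator B \<and> compact_operator (A' \<circ> B))"
    using that not_closed_range_if_noncompact_with_compact_comp by (auto simp: bounded_clinear_iff)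
qed

end
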